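(* Consider two adjacent cells $j$ and $j+1$ and write $x_-=\min(0,x)$. Consider the centered interface velocity $$u^\star_{j+1/2}=\frac{u_j+u_{j+1}}{2}$$ and the half-cell pressure $$\tilde p_{j,+}=\frac{p_j+p^\star_{j+1/2}}{2}-\alpha\,(\rho c)_j\,(u^\star_{j+1/2}-u_j)_- -\beta\,\rho_j\,|u^\star_{j+1/2}-u_j|\,(u^\star_{j+1/2}-u_j)_-,$$ for some pseudo-viscosity constants $\alpha$ and $\beta$, with the similar symmetric expression $$\tilde p_{j+1,-}=\frac{p_{j+1}+p^\star_{j+1/2}}{2}-\alpha\,(\rho c)_{j+1}\,(u_{j+1}-u^\star_{j+1/2})_- -\beta\,\rho_{j+1}\,|u_{j+1}-u^\star_{j+1/2}|\,(u_{j+1}-u^\star_{j+1/2})_-.$$ Then: 1. From the compatibility relation $$\tilde p_{j,+}\,(u^\star_{j+1/2}-u_j)+\tilde p_{j+1,-}\,(u_{j+1}-u^\star_{j+1/2})=p^\star_{j+1/2}\,(u_{j+1}-u_j)$$ we get the unique admissible value for the interface pressure $p^\star_{j+1/2}$: $$p^\star_{j+1/2}=\frac{\tilde p_{j,+}+\tilde p_{j+1,-}}{2}.$$ 2. We get the following half-cell entropy production: $$m_{j,+}\frac{d e_{j,+}}{dt}+\frac{p_j+p^\star_{j+1/2}}{2}\,(u^\star_{j+1/2}-u_j)=\pi_{j,+}$$ with $$\pi_{j,+}=\alpha\,(\rho c)_j\,[(u^\star_{j+1/2}-u_j)_-]^2+\beta\,\rho_j\,|u^\star_{j+1/2}-u_j|\,[(u^\star_{j+1/2}-u_j)_-]^2\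 \ge 0.$$ For large velocity jumps $|u_{j+1}-u_j|$, we have $$\pi_{j,+}=O(|u_{j+1}-u_j|^3).$$
   Context: Setting: the one-dimensional compressible Euler equations with density $\rho$, velocity $u$, pressure $p$, specific internal energy $e$, and specific total energy $E=e+\tfrac12u^2$. The equation of state is that of a perfect gas, $p=(\gamma-1)\rho e$ with $\gamma\in(1,3]$, and the sound speed $c>0$ is given by $c^2=\gamma p/\rho$. Set $q=pu$; a subscript $j$ denotes the piecewise constant value in cell $j$, so that $q_j=p_ju_j$ and $(\rho c)_j=\rho_jc_j$. Each cell $j$ is split into a left half-cell $(j,-)$ and a right half-cell $(j,+)$. Let $p^\star_{j+1/2}$ and $u^\star_{j+1/2}$ be the pressure and velocity at the interface between cells $j$ and $j+1$, and let $q^\star_{j+1/2}$ be an interface quantity consistent with $q=pu$ (not necessarily equal to $p^\star_{j+1/2}u^\star_{j+1/2}$). Semi-discrete Lagrangian evolution in the right half-cell $(j,+)$: the mass $m_{j,+}$ of the half-cell is constant in time, and $$m_{j,+}\frac{du_{j,+}}{dt}=-(p^\star_{j+1/2}-p_j),\qquad m_{j,+}\frac{dE_{j,+}}{dt}=-(q^\star_{j+1/2}-q_j),\qquad E_{j,+}=\tfrac12u_{j,+}^2+e_{j,+}.$$ At the "initial time", where the relations are considered, one takes $u_{j,-}=u_{j,+}=u_j$ in every cell $j$ (first-order piecewise constant discretization). The half-cell pseudo-pressures $\tilde p_{j,+}$, $\tilde p_{j+1,-}$ are introduced so that the internal energy balance in the right half-cell of cell $j$ takes the form $m_{j,+}\frac{de_{j,+}}{dt}+\tilde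 p_{j,+}(u^\star_{j+1/2}-u_j)=0$, and similarly in the left half-cell of cell $j+1$. This requires the two half-cell compatibility relations $$\tilde p_{j,+}(u^\star_{j+1/2}-u_j)+u_j(p^\star_{j+1/2}-p_j)=q^\star_{j+1/2}-q_j,$$ $$\tilde p_{j+1,-}(u_{j+1}-u^\star_{j+1/2})+u_{j+1}(p_{j+1}-p^\star_{j+1/2})=q_{j+1}-q^\star_{j+1/2}.$$ Their difference gives an expression for $q^\star_{j+1/2}$ in terms of $u^\star_{j+1/2},p^\star_{j+1/2},\tilde p_{j,+},\tilde p_{j+1,-}$, and their sum is the compatibility relation appearing in item 1 of the claim. The pseudo-viscosity constants $\alpha$ and $\beta$ are dimensionless free parameters left to the user.
   Formalization: Uniqueness of the interface pressure from the compatibility relation is claimed only when u_j ≠ u_{j+1} (otherwise the relation reads 0 = 0), and π_{j,+} ≥ 0 only for α, β ≥ 0 (it fails, for example, for α < 0, β = 0 in compression). *)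

theory Defs
  imports Complex_Main "HOL-Library.Landau_Symbols"
begin

text \<open>
  Cell quantities (density, velocity, pressure, specific internal energy, sound speed) are
  functions of the cell index, of type \<^typ>\<open>int \<Rightarrow> real\<close>. Quantities attached to the interface
  between cells \<open>j\<close> and \<open>j + 1\<close> are indexed by \<open>j\<close>; the interface pressure \<open>ps\<close> and the interface
  quantity \<open>qs\<close> (consistent with \<open>q = p u\<close>) are plain real numbers.
\<close>

definition perfect_gas :: "real \<Rightarrow> real \<Rightarrow> real \<Rightarrow> real \<Rightarrow> real \<Rightarrow> bool" where
  "perfect_gas \<gamma> \<rho> p e c \<longleftrightarrow> \<rho> > 0 \<and> c > 0 \<and> p = (\<gamma> - 1) * \<rho> * e \<and> c\<^sup>2 = \<gamma> * p / \<rho>"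

definition neg_part :: "real \<Rightarrow> real" where
  "neg_part x = min 0 x"

definition u_star :: "(int \<Rightarrow> real) \<Rightarrow> int \<Rightarrow> real" where
  "u_star u j = (u j + u (j + 1)) / 2"

text \<open>The pseudo-pressure in the right half-cell of cell \<open>j\<close>, as a function of \<open>ps\<close>.\<close>

definition p_tilde_right ::
  "real \<Rightarrow> real \<Rightarrow> (int \<Rightarrow> real) \<Rightarrow> (int \<Rightarrow> real) \<Rightarrow> (int \<Rightarrow> real) \<Rightarrow> (int \<Rightarrow> real) \<Rightarrow> int \<Rightarrow> real \<Rightarrow> real"
where
  "p_tilde_right \<alpha> \<beta> \<rho> c p u j ps =
     (p j + ps) / 2
     - \<alpha> * (\<rho> j * c j) * neg_part (u_star u j - u j)
     - \<beta> * \<rho> j * \<bar>u_star u j - u j\<bar> * neg_part (u_star u j - u j)"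

text \<open>
  The pseudo-pressure on the other side of the same interface, i.e. in the left half-cell of
  cell \<open>j + 1\<close> (the index argument is that of the interface).
\<close>

definition p_tilde_left ::
  "real \<Rightarrow> real \<Rightarrow> (int \<Rightarrow> real) \<Rightarrow> (int \<Rightarrow> real) \<Rightarrow> (int \<Rightarrow> real) \<Rightarrow> (int \<Rightarrow> real) \<Rightarrow> int \<Rightarrow> real \<Rightarrow> real"
where
  "p_tilde_left \<alpha> \<beta> \<rho> c p u j ps =
     (p (j + 1) + ps) / 2
     - \<alpha> * (\<rho> (j + 1) * c (j + 1)) * neg_part (u (j + 1) - u_star u j)
     - \<beta> * \<rho> (j + 1) * \<bar>u (j + 1) - u_star u j\<bar> * neg_part (u (j + 1) - u_star u j)"

text \<open>
  The two half-cell compatibility relations at the interface, with \<open>q j = p j * u j\<close>;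
  \<open>ptr\<close> and \<open>ptl\<close> are the pseudo-pressures to the left and to the right of the interface.
\<close>

definition half_cell_compat ::
  "(int \<Rightarrow> real) \<Rightarrow> (int \<Rightarrow> real) \<Rightarrow> int \<Rightarrow> real \<Rightarrow> real \<Rightarrow> real \<Rightarrow> real \<Rightarrow> bool"
where
  "half_cell_compat p u j ptr ptl ps qs \<longleftrightarrow>
     ptr * (u_star u j - u j) + u j * (ps - p j) = qs - p j * u j \<and>
     ptl * (u (j + 1) - u_star u j) + u (j + 1) * (p (j + 1) - ps) = p (j + 1) * u (j + 1) - qs"

text \<open>The sum of the two half-cell relations.\<close>

definition interface_compat :: "(int \<Rightarrow> real) \<Rightarrow> int \<Rightarrow> real \<Rightarrow> real \<Rightarrow> real \<Rightarrow> bool" where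
  "interface_compat u j ptr ptl ps \<longleftrightarrow>
     ptr * (u_star u j - u j) + ptl * (u (j + 1) - u_star u j) = ps * (u (j + 1) - u j)"

text \<open>
  Semi-discrete Lagrangian evolution of the right half-cell of cell \<open>j\<close>. The functions \<open>uh\<close>, \<open>Eh\<close>,
  \<open>eh\<close> of time are the velocity and the specific total and internal energies of the half-cell,
  \<open>m\<close> is its mass. The balance laws are required at the initial time \<open>t0\<close> only, so the time
  derivatives are one-sided.
\<close>

definition right_half_cell_evolution ::
  "(int \<Rightarrow> real) \<Rightarrow> (int \<Rightarrow> real) \<Rightarrow> int \<Rightarrow> real \<Rightarrow> real \<Rightarrow> real \<Rightarrow> real \<Rightarrow>
     (real \<Rightarrow> real) \<Rightarrow> (real \<Rightarrow> real) \<Rightarrow> (real \<Rightarrow> real) \<Rightarrow> bool"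
where
  "right_half_cell_evolution p u j ps qs m t0 uh Eh eh \<longleftrightarrow>
     m > 0 \<and>
     uh t0 = u j \<and>
     (\<forall>t\<ge>t0. Eh t = (uh t)\<^sup>2 / 2 + eh t) \<and>
     (\<exists>du. (uh has_real_derivative du) (at t0 within {t0..}) \<and> m * du = - (ps - p j)) \<and>
     (\<exists>dE. (Eh has_real_derivative dE) (at t0 within {t0..}) \<and> m * dE = - (qs - p j * u j))"

definition entropy_production ::
  "real \<Rightarrow> real \<Rightarrow> (int \<Rightarrow> real) \<Rightarrow> (int \<Rightarrow> real) \<Rightarrow> (int \<Rightarrow> real) \<Rightarrow> int \<Rightarrow> real"
where
  "entropy_production \<alpha> \<beta> \<rho> c u j =
     \<alpha> * (\<rho> j * c j) * (neg_part (u_star u j - u j))\<^sup>2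
     + \<beta> * \<rho> j * \<bar>u_star u j - u j\<bar> * (neg_part (u_star u j - u j))\<^sup>2"

text \<open>
  The regime of large velocity jumps across the interface: a property holds eventually iff, for some
  bound, it holds for all velocity fields whose jump exceeds the bound in absolute value.
\<close>

definition large_jump :: "int \<Rightarrow> (int \<Rightarrow> real) filter" where
  "large_jump j = filtercomap (\<lambda>v. \<bar>v (j + 1) - v j\<bar>) at_top"

end

theory Submission
  imports Defs
begin

text \<open>
  With the centered interface velocity, both half-cells see the same velocity increment
  \<open>\<delta> = (u (j + 1) - u j) / 2\<close>. The sum of the half-cell relations is therefore \<open>\<delta>\<close> times the relation
  \<open>ptr + ptl = 2 * ps\<close>, and dividing by \<open>\<delta>\<close> is possible exactly when the velocity jumps
  (lemma \<open>interface_compat_iff\<close>). That relation is implicit, since the pseudo-pressures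
  themselves contain \<open>ps\<close>; but each contains it as \<open>ps / 2\<close>, so the implicit relation is an affine
  fixed-point equation with slope \<open>1 / 2\<close> and has exactly one solution
  (lemma \<open>ex1_interface_pressure\<close>).

  For the entropy production, subtracting \<open>u j\<close> times the momentum balance from the total energy
  balance gives the internal energy balance, in which the half-cell compatibility relation turns
  the flux differences into the work of the pseudo-pressure
  (lemma \<open>right_half_cell_internal_energy\<close>). The pseudo-pressure is the mean pressure minus a
  viscous part proportional to the negative part of \<open>\<delta>\<close>, and \<open>\<delta> * neg_part \<delta> = (neg_part \<delta>)\<^sup>2\<close>, so the
  work of the viscous part is the entropy production, nonnegative for nonnegative \<open>\<alpha>\<close> and \<open>\<beta>\<close>. It is
  the sum of a term of order two and a term of order three in \<open>\<delta>\<close>, hence at most cubic for large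
  jumps.
\<close>

lemma u_star_diff_left: "u_star u j - u j = (u (j + 1) - u j) / 2"
  by (simp add: u_star_def field_simps)

lemma u_star_diff_right: "u (j + 1) - u_star u j = (u (j + 1) - u j) / 2"
  by (simp add: u_star_def field_simps)

lemma mult_neg_part: "x * neg_part x = (neg_part x)\<^sup>2"
  by (simp add: neg_part_def min_def power2_eq_square)

lemma neg_part_power2_le: "(neg_part x)\<^sup>2 \<le> x\<^sup>2"
  by (simp add: neg_part_def min_def)

lemma interface_compat_iff:
  "interface_compat u j a b ps \<longleftrightarrow> u j = u (j + 1) \<or> ps = (a + b) / 2"
proof -
  have "a * ((u (j + 1) - u j) / 2) + b * ((u (j + 1) - u j) / 2) - ps * (u (j + 1) - u j)
      = (u (j + 1) - u j) * ((a + b) / 2 - ps)"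
    by (simp add: field_simps)
  then have "interface_compat u j a b ps \<longleftrightarrow> (u (j + 1) - u j) * ((a + b) / 2 - ps) = 0"
    unfolding interface_compat_def u_star_diff_left u_star_diff_right
    by linarith
  then show ?thesis
    by auto
qed

lemma ex1_interface_pressure:
  "\<exists>!ps. ps = (p_tilde_right \<alpha> \<beta> \<rho> c p u j ps + p_tilde_left \<alpha> \<beta> \<rho> c p u j ps) / 2"
proof -
  \<comment> \<open>The parts of the pseudo-pressures that do not depend on \<open>ps\<close>; their sum is the fixed point.\<close>
  define a where "a = p_tilde_right \<alpha> \<beta> \<rho> c p u j 0"
  define b where "b = p_tilde_left \<alpha> \<beta> \<rho> c p u j 0"
  have affine: "p_tilde_right \<alpha> \<beta> \<rho> c p u j ps = a + ps / 2"
    "p_tilde_left \<alpha> \<beta> \<rho> c p u j ps = b + ps / 2" for ps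
    by (simp_all add: a_def b_def p_tilde_right_def p_tilde_left_def add_divide_distrib)
  have "ps = (p_tilde_right \<alpha> \<beta> \<rho> c p u j ps + p_tilde_left \<alpha> \<beta> \<rho> c p u j ps) / 2
      \<longleftrightarrow> ps = a + b" for ps
    unfolding affine by (auto simp: field_simps)
  then show ?thesis
    by simp
qed

text \<open>
  The kinetic energy changes at the rate \<open>u j * du\<close>, because the half-cell velocity equals the
  cell velocity at the initial time; removing it from the total energy balance leaves
  \<open>u j * (ps - p j) - (qs - p j * u j)\<close>, which the compatibility relation identifies as the work
  of the pseudo-pressure \<open>ptr\<close>.
\<close>

lemma right_half_cell_internal_energy:
  assumes compat: "half_cell_compat p u j ptr ptl ps qs"
    and evol: "right_half_cell_evolution p u j ps qs m t0 uh Eh eh"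
  shows "\<exists>de. (eh has_real_derivative de) (at t0 within {t0..}) \<and>
    m * de + ptr * (u_star u j - u j) = 0"
proof -
  from evol obtain du dE where
      u0: "uh t0 = u j" and energy: "\<forall>t\<ge>t0. Eh t = (uh t)\<^sup>2 / 2 + eh t"
      and du: "(uh has_real_derivative du) (at t0 within {t0..})" "m * du = - (ps - p j)"
      and dE: "(Eh has_real_derivative dE) (at t0 within {t0..})" "m * dE = - (qs - p j * u j)"
    unfolding right_half_cell_evolution_def by auto
  have "((\<lambda>t. Eh t - (uh t)\<^sup>2 / 2) has_real_derivative dE - u j * du) (at t0 within {t0..})"
    by (rule derivative_eq_intros du(1) dE(1) refl | simp add: u0)+
  then have deriv: "(eh has_real_derivative dE - u j * du) (at t0 within {t0..})"
    by (rule has_field_derivative_transform_within[where d = 1]) (use energy in auto)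
  have "m * (dE - u j * du) = m * dE - u j * (m * du)"
    by (simp add: algebra_simps)
  also have "\<dots> = u j * (ps - p j) - (qs - p j * u j)"
    unfolding du(2) dE(2) by (simp add: algebra_simps)
  also have "\<dots> = - (ptr * (u_star u j - u j))"
    using compat unfolding half_cell_compat_def by linarith
  finally have "m * (dE - u j * du) + ptr * (u_star u j - u j) = 0"
    by simp
  with deriv show ?thesis
    by blast
qed

lemma pseudo_pressure_work:
  "p_tilde_right \<alpha> \<beta> \<rho> c p u j ps * (u_star u j - u j)
    = (p j + ps) / 2 * (u_star u j - u j) - entropy_production \<alpha> \<beta> \<rho> c u j"
  unfolding p_tilde_right_def entropy_production_def
  by (simp add: mult_neg_part[symmetric] algebra_simps)

lemma entropy_production_nonneg:
  assumes "\<alpha> \<ge> 0" "\<beta> \<ge> 0" "\<rho> j \<ge> 0" "c j \<ge> 0"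
  shows "entropy_production \<alpha> \<beta> \<rho> c u j \<ge> 0"
  unfolding entropy_production_def using assms by simp

text \<open>
  Only the term of the linear viscosity \<open>\<alpha>\<close> needs a large jump: it is quadratic in the jump, and a
  square is bounded by a cube from size one on. The term of the quadratic viscosity \<open>\<beta>\<close> is cubic
  from the start.
\<close>

lemma entropy_production_cubic_bound:
  assumes jump: "1 \<le> \<bar>u (j + 1) - u j\<bar>"
  shows "\<bar>entropy_production \<alpha> \<beta> \<rho> c u j\<bar>
    \<le> (\<bar>\<alpha> * (\<rho> j * c j)\<bar> + \<bar>\<beta> * \<rho> j\<bar>) * \<bar>u (j + 1) - u j\<bar> ^ 3"
proof -
  define J where "J = \<bar>u (j + 1) - u j\<bar>"
  define d where "d = u_star u j - u j"
  have J: "1 \<le> J"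
    using jump by (simp add: J_def)
  have d: "\<bar>d\<bar> \<le> J"
    by (simp add: d_def J_def u_star_diff_left)
  have "(neg_part d)\<^sup>2 \<le> \<bar>d\<bar>\<^sup>2"
    using neg_part_power2_le by simp
  also have "\<dots> \<le> J\<^sup>2"
    using d by (intro power_mono) auto
  finally have sq: "(neg_part d)\<^sup>2 \<le> J\<^sup>2" .
  also have "\<dots> \<le> J ^ 3"
    using J by (intro power_increasing) auto
  finally have quadratic: "(neg_part d)\<^sup>2 \<le> J ^ 3" .
  have "\<bar>d\<bar> * (neg_part d)\<^sup>2 \<le> J * J\<^sup>2"
    using d sq J by (intro mult_mono) auto
  then have cubic: "\<bar>d\<bar> * (neg_part d)\<^sup>2 \<le> J ^ 3"
    by (simp add: power3_eq_cube power2_eq_square)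
  have "\<bar>entropy_production \<alpha> \<beta> \<rho> c u j\<bar>
      \<le> \<bar>\<alpha> * (\<rho> j * c j) * (neg_part d)\<^sup>2\<bar> + \<bar>\<beta> * \<rho> j * \<bar>d\<bar> * (neg_part d)\<^sup>2\<bar>"
    unfolding entropy_production_def d_def by (rule abs_triangle_ineq)
  also have "\<dots> = \<bar>\<alpha> * (\<rho> j * c j)\<bar> * (neg_part d)\<^sup>2 + \<bar>\<beta> * \<rho> j\<bar> * (\<bar>d\<bar> * (neg_part d)\<^sup>2)"
    by (simp add: abs_mult)
  also have "\<dots> \<le> \<bar>\<alpha> * (\<rho> j * c j)\<bar> * J ^ 3 + \<bar>\<beta> * \<rho> j\<bar> * J ^ 3"
    using quadratic cubic by (intro add_mono mult_left_mono) auto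
  finally show ?thesis
    by (simp add: J_def distrib_right)
qed

lemma eventually_large_jump: "eventually (\<lambda>v. B \<le> \<bar>v (j + 1) - v j\<bar>) (large_jump j)"
  unfolding large_jump_def eventually_filtercomap
  using eventually_ge_at_top by blast

lemma entropy_production_bigo:
  "(\<lambda>v. entropy_production \<alpha> \<beta> \<rho> c v j) \<in> O[large_jump j](\<lambda>v. \<bar>v (j + 1) - v j\<bar> ^ 3)"
proof (rule bigoI)
  show "eventually (\<lambda>v. norm (entropy_production \<alpha> \<beta> \<rho> c v j)
      \<le> (\<bar>\<alpha> * (\<rho> j * c j)\<bar> + \<bar>\<beta> * \<rho> j\<bar>) * norm (\<bar>v (j + 1) - v j\<bar> ^ 3)) (large_jump j)"
    using eventually_large_jump[of 1 j]
  proof eventually_elim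
    case (elim v)
    from entropy_production_cubic_bound[OF this] show ?case
      by simp
  qed
qed

theorem theorem1:
  fixes \<gamma> \<alpha> \<beta> :: real
    and \<rho> u p e c :: "int \<Rightarrow> real"
    and j :: int
  assumes gamma: "1 < \<gamma>" "\<gamma> \<le> 3"
    and gas: "\<forall>i\<in>{j, j + 1}. perfect_gas \<gamma> (\<rho> i) (p i) (e i) (c i)"
  defines "ptr \<equiv> p_tilde_right \<alpha> \<beta> \<rho> c p u j"
    and "ptl \<equiv> p_tilde_left \<alpha> \<beta> \<rho> c p u j"
  shows
    "((\<exists>!ps. ps = (ptr ps + ptl ps) / 2) \<and>
      (\<forall>ps. ps = (ptr ps + ptl ps) / 2 \<longrightarrow> interface_compat u j (ptr ps) (ptl ps) ps) \<and>
      (u j \<noteq> u (j + 1) \<longrightarrow>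
        (\<exists>!ps. interface_compat u j (ptr ps) (ptl ps) ps) \<and>
        (\<forall>ps. interface_compat u j (ptr ps) (ptl ps) ps \<longrightarrow> ps = (ptr ps + ptl ps) / 2)))
     \<and>
     (\<forall>ps qs m t0 uh Eh eh.
        half_cell_compat p u j (ptr ps) (ptl ps) ps qs \<longrightarrow>
        right_half_cell_evolution p u j ps qs m t0 uh Eh eh \<longrightarrow>
        (\<exists>de. (eh has_real_derivative de) (at t0 within {t0..}) \<and>
              m * de + (p j + ps) / 2 * (u_star u j - u j) = entropy_production \<alpha> \<beta> \<rho> c u j))
     \<and>
     (\<alpha> \<ge> 0 \<longrightarrow> \<beta> \<ge> 0 \<longrightarrow> entropy_production \<alpha> \<beta> \<rho> c u j \<ge> 0)
     \<and>
     (\<lambda>v. entropy_production \<alpha> \<beta> \<rho> c v j) \<in> O[large_jump j](\<lambda>v. \<bar>v (j + 1) - v j\<bar> ^ 3)"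
proof -
  have pressure: "\<exists>!ps. ps = (ptr ps + ptl ps) / 2"
    unfolding ptr_def ptl_def by (rule ex1_interface_pressure)
  have balance: "\<exists>de. (eh has_real_derivative de) (at t0 within {t0..}) \<and>
      m * de + (p j + ps) / 2 * (u_star u j - u j) = entropy_production \<alpha> \<beta> \<rho> c u j"
    if compat: "half_cell_compat p u j (ptr ps) (ptl ps) ps qs"
      and evol: "right_half_cell_evolution p u j ps qs m t0 uh Eh eh"
    for ps qs m t0 uh Eh eh
  proof -
    obtain de where de: "(eh has_real_derivative de) (at t0 within {t0..})"
        "m * de + ptr ps * (u_star u j - u j) = 0"
      using right_half_cell_internal_energy[OF compat evol] by blast
    have "m * de + (p j + ps) / 2 * (u_star u j - u j) = entropy_production \<alpha> \<beta> \<rho> c u j"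
      using de(2) unfolding ptr_def pseudo_pressure_work by linarith
    with de(1) show ?thesis
      by blast
  qed
  have "\<rho> j \<ge> 0" "c j \<ge> 0"
    using gas by (auto simp: perfect_gas_def)
  then show ?thesis
    using pressure balance entropy_production_bigo
    by (auto simp: interface_compat_iff entropy_production_nonneg)
qed

end
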